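(* For all positive integers $n,p$, $$\Omega(\mathtt{RP}(n,p))\le \mathtt{PO}(n,p)\le O(\mathtt{RP}(n,p)\log n).$$
   Context: Given a directed graph $G=(V,E)$ and a set $P\subseteq V\times V$ of demand pairs, a reachability preserver is a subgraph $H\subseteq G$ such that for every $(s,t)\in P$ for which $G$ has an $s\leadsto t$ path, $H$ also has one. $\mathtt{RP}(n,p)$ is the least integer such that every $n$-node directed graph and set of $|P|=p$ demand pairs has a reachability preserver on at most $\mathtt{RP}(n,p)$ edges. A path oracle for $G,P$ is a data structure (a bit string, together with a fixed decoding procedure) that, when queried with any $(s,t)\in P$, reports an $s\leadsto t$ path in $G$ (or "no path" if none exists). $\mathtt{PO}(n,p)$ is the smallest integer such that every $n$-node directed graph and set of $|P|=p$ demand pairs has a path oracle on at most $\mathtt{PO}(n,p)$ bits. *)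

theory Defs
  imports Complex_Main
begin

definition verts :: "nat \<Rightarrow> nat set" where
  "verts n = {0..<n}"

definition is_digraph :: "nat \<Rightarrow> (nat \<times> nat) set \<Rightarrow> bool" where
  "is_digraph n E \<longleftrightarrow> E \<subseteq> verts n \<times> verts n \<and> (\<forall>v. (v, v) \<notin> E)"

definition is_demand_set :: "nat \<Rightarrow> nat \<Rightarrow> (nat \<times> nat) set \<Rightarrow> bool" where
  "is_demand_set n p P \<longleftrightarrow> P \<subseteq> verts n \<times> verts n \<and> finite P \<and> card P = p"

definition reaches :: "(nat \<times> nat) set \<Rightarrow> nat \<Rightarrow> nat \<Rightarrow> bool" where
  "reaches E s t \<longleftrightarrow> (s, t) \<in> E\<^sup>*"

definition reach_preserver :: "(nat \<times> nat) set \<Rightarrow> (nat \<times> nat) set \<Rightarrow> (nat \<times> nat) set \<Rightarrow> bool" where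
  "reach_preserver E P H \<longleftrightarrow> H \<subseteq> E \<and> (\<forall>(s, t) \<in> P. reaches E s t \<longrightarrow> reaches H s t)"

definition RP :: "nat \<Rightarrow> nat \<Rightarrow> nat" where
  "RP n p = (LEAST k. \<forall>E P. is_digraph n E \<and> is_demand_set n p P \<longrightarrow>
       (\<exists>H. reach_preserver E P H \<and> card H \<le> k))"

definition is_path :: "(nat \<times> nat) set \<Rightarrow> nat \<Rightarrow> nat \<Rightarrow> nat list \<Rightarrow> bool" where
  "is_path E s t xs \<longleftrightarrow> xs \<noteq> [] \<and> hd xs = s \<and> last xs = t \<and>
     (\<forall>i. Suc i < length xs \<longrightarrow> (xs ! i, xs ! Suc i) \<in> E)"

type_synonym decoder = "bool list \<Rightarrow> nat \<Rightarrow> nat \<Rightarrow> nat list option"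

definition is_path_oracle :: "decoder \<Rightarrow> bool list \<Rightarrow> (nat \<times> nat) set \<Rightarrow> (nat \<times> nat) set \<Rightarrow> bool" where
  "is_path_oracle D B E P \<longleftrightarrow> (\<forall>(s, t) \<in> P.
       (reaches E s t \<longrightarrow> (\<exists>xs. D B s t = Some xs \<and> is_path E s t xs)) \<and>
       (\<not> reaches E s t \<longrightarrow> D B s t = None))"

definition PO :: "nat \<Rightarrow> nat \<Rightarrow> nat" where
  "PO n p = (LEAST k. \<exists>D::decoder. \<forall>E P. is_digraph n E \<and> is_demand_set n p P \<longrightarrow>
       (\<exists>B. length B \<le> k \<and> is_path_oracle D B E P))"

end

theory Submission
  imports Defs
begin

text \<open>
  Upper bound: store a reachability preserver with at most \<open>RP n p\<close> edges as a list of edges.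

  Lower bound: a digraph \<open>E\<close> with demands \<open>P\<close> that is extremal for \<open>RP n p\<close> can be taken critical,
  that is, every edge lies on all paths of some demand pair. Some set \<open>S\<close> of at most half of the
  vertices spans a constant fraction of the edges. Walks whose edges all leave \<open>S\<close> are contracted to
  shortcuts inside \<open>S\<close>, which keeps the edges \<open>M\<close> spanned by \<open>S\<close> critical and frees the remaining
  vertices. The freed vertices provide a private twin \<open>f v\<close> for each \<open>v \<in> S\<close>, and for every subset
  \<open>X\<close> of \<open>M\<close> one reroutes each edge \<open>(u, v) \<in> X\<close> as \<open>u \<rightarrow> f v \<rightarrow> v\<close>. The demands are the same for all
  these digraphs, and by criticality the reported paths reveal \<open>X\<close>; hence at least \<open>card M\<close> bits
  are needed.
\<close>

section \<open>Paths and reachability\<close>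

lemma is_path_Cons_Cons:
  "is_path E s t (x # y # xs) \<longleftrightarrow> s = x \<and> (x, y) \<in> E \<and> is_path E y t (y # xs)"
proof -
  have "(\<forall>i. Suc i < length (x # y # xs) \<longrightarrow> ((x # y # xs) ! i, (x # y # xs) ! Suc i) \<in> E) \<longleftrightarrow>
      (x, y) \<in> E \<and> (\<forall>i. Suc i < length (y # xs) \<longrightarrow> ((y # xs) ! i, (y # xs) ! Suc i) \<in> E)"
    (is "?L \<longleftrightarrow> ?R")
  proof
    assume L: ?L
    have "(x, y) \<in> E" using L[rule_format, of 0] by simp
    moreover have "((y # xs) ! i, (y # xs) ! Suc i) \<in> E" if "Suc i < length (y # xs)" for i
      using L[rule_format, of "Suc i"] that by simp
    ultimately show ?R by blast
  next
    assume R: ?R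
    show ?L
    proof (intro allI impI)
      fix i assume "Suc i < length (x # y # xs)"
      then show "((x # y # xs) ! i, (x # y # xs) ! Suc i) \<in> E"
        using R by (cases i) auto
    qed
  qed
  then show ?thesis unfolding is_path_def by auto
qed

lemma is_path_imp_rtrancl: "is_path E s t xs \<Longrightarrow> (s, t) \<in> E\<^sup>*"
proof (induction xs arbitrary: s)
  case Nil
  then show ?case by (simp add: is_path_def)
next
  case (Cons x xs)
  show ?case
  proof (cases xs)
    case Nil
    then show ?thesis using Cons.prems by (auto simp: is_path_def)
  next
    case (Cons y ys)
    then have "s = x" "(x, y) \<in> E" "is_path E y t xs"
      using Cons.prems by (simp_all add: is_path_Cons_Cons)
    then show ?thesis using Cons.IH by (meson converse_rtrancl_into_rtrancl)
  qed
qed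

lemma rtrancl_imp_is_path:
  assumes "(s, t) \<in> E\<^sup>*"
  shows "\<exists>xs. is_path E s t xs"
  using assms
proof (induction rule: converse_rtrancl_induct)
  case base
  have "is_path E t t [t]" by (simp add: is_path_def)
  then show ?case by blast
next
  case (step y z)
  then obtain xs where xs: "is_path E z t xs" by blast
  then obtain zs where "xs = z # zs" by (cases xs) (auto simp: is_path_def)
  then have "is_path E y t (y # xs)" using xs step.hyps by (simp add: is_path_Cons_Cons)
  then show ?case by blast
qed

lemma is_path_mono: "is_path E s t xs \<Longrightarrow> E \<subseteq> F \<Longrightarrow> is_path F s t xs"
  by (auto simp: is_path_def)

text \<open>Turns a single oracle answer that is correct for two digraphs into a walk along their
  common edges.\<close>

lemma is_path_Int: "is_path E s t xs \<Longrightarrow> is_path F s t xs \<Longrightarrow> is_path (E \<inter> F) s t xs"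
  by (auto simp: is_path_def)

section \<open>Preservers with few edges\<close>

lemma digraph_card_le:
  assumes "is_digraph n E"
  shows "finite E" "card E \<le> n * n"
proof -
  have sub: "E \<subseteq> verts n \<times> verts n" and fin: "finite (verts n \<times> verts n)"
    using assms by (auto simp: is_digraph_def verts_def)
  show "finite E" using finite_subset[OF sub fin] .
  show "card E \<le> n * n" using card_mono[OF fin sub] by (simp add: verts_def)
qed

lemma digraph_subset: "is_digraph n E \<Longrightarrow> H \<subseteq> E \<Longrightarrow> is_digraph n H"
  by (auto simp: is_digraph_def)

lemma square_bounds_preservers:
  assumes "is_digraph n E"
  shows "\<exists>H. reach_preserver E P H \<and> card H \<le> n * n"
  using digraph_card_le(2)[OF assms] by (intro exI[of _ E]) (simp add: reach_preserver_def)

text \<open>The bound \<open>n * n\<close> is admissible because \<open>E\<close> preserves itself,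
  so the \<open>LEAST\<close> in \<open>RP\<close> is attained.\<close>

lemma RP_preserver:
  assumes "is_digraph n E" "is_demand_set n p P"
  shows "\<exists>H. reach_preserver E P H \<and> card H \<le> RP n p"
proof -
  have "\<forall>E P. is_digraph n E \<and> is_demand_set n p P \<longrightarrow> (\<exists>H. reach_preserver E P H \<and> card H \<le> n * n)"
    using square_bounds_preservers by blast
  from LeastI[of "\<lambda>k. \<forall>E P. is_digraph n E \<and> is_demand_set n p P \<longrightarrow>
       (\<exists>H. reach_preserver E P H \<and> card H \<le> k)", OF this]
  show ?thesis using assms unfolding RP_def by blast
qed

lemma RP_le_square: "RP n p \<le> n * n"
  unfolding RP_def using square_bounds_preservers by (intro Least_le) blast

definition critical :: "(nat \<times> nat) set \<Rightarrow> (nat \<times> nat) set \<Rightarrow> bool" where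
  "critical E P \<longleftrightarrow> (\<forall>e \<in> E. \<exists>(s, t) \<in> P. (s, t) \<in> E\<^sup>* \<and> (s, t) \<notin> (E - {e})\<^sup>*)"

text \<open>Since \<open>RP n p - 1\<close> is not admissible, some instance has only preservers
  with at least \<open>RP n p\<close> edges. A preserver of least cardinality then replaces the
  digraph: dropping any of its edges breaks a demand.\<close>

lemma critical_extremal_digraph:
  assumes "RP n p \<ge> 1"
  obtains E P where "is_digraph n E" "is_demand_set n p P" "RP n p \<le> card E" "critical E P"
proof -
  have "\<not> (\<forall>E P. is_digraph n E \<and> is_demand_set n p P \<longrightarrow>
       (\<exists>H. reach_preserver E P H \<and> card H \<le> RP n p - 1))"
  proof
    assume "\<forall>E P. is_digraph n E \<and> is_demand_set n p P \<longrightarrow>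
       (\<exists>H. reach_preserver E P H \<and> card H \<le> RP n p - 1)"
    then have "RP n p \<le> RP n p - 1" by (subst RP_def, intro Least_le)
    then show False using assms by simp
  qed
  then obtain E P where EP: "is_digraph n E" "is_demand_set n p P"
    and large: "\<And>H. reach_preserver E P H \<Longrightarrow> RP n p \<le> card H"
    using assms by force
  have "reach_preserver E P E" by (simp add: reach_preserver_def)
  then obtain H where H: "reach_preserver E P H"
    and least: "\<And>H'. reach_preserver E P H' \<Longrightarrow> card H \<le> card H'"
    using ex_has_least_nat[of "reach_preserver E P" E card] by blast
  have HE: "H \<subseteq> E" using H by (simp add: reach_preserver_def)
  have dH: "is_digraph n H" using digraph_subset[OF EP(1) HE] .
  have "critical H P"
    unfolding critical_def
  proof
    fix e assume e: "e \<in> H"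
    have "card (H - {e}) < card H" using e digraph_card_le(1)[OF dH] by (rule card_Diff1_less[rotated])
    then have "\<not> reach_preserver E P (H - {e})" using least by (meson not_le)
    then obtain s t where "(s, t) \<in> P" "(s, t) \<in> E\<^sup>*" "(s, t) \<notin> (H - {e})\<^sup>*"
      using HE by (auto simp: reach_preserver_def reaches_def)
    moreover from this have "(s, t) \<in> H\<^sup>*" using H by (auto simp: reach_preserver_def reaches_def)
    ultimately show "\<exists>(s, t) \<in> P. (s, t) \<in> H\<^sup>* \<and> (s, t) \<notin> (H - {e})\<^sup>*" by blast
  qed
  then show thesis using that[OF dH EP(2) large[OF H]] by blast
qed

section \<open>The upper bound\<close>

text \<open>A preserver is coded as a list of exactly \<open>RP n p\<close> vertex pairs. Each pair
  is worth \<open>2 * L\<close> bits, so these lists inject into the bit strings of one fixed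
  length. The decoder inverts the injection and returns any path of the decoded preserver.\<close>

lemma oracle_from_preservers:
  assumes n: "n \<ge> 1" and L: "n \<le> 2 ^ L"
  shows "\<exists>D::decoder. \<forall>E P. is_digraph n E \<and> is_demand_set n p P \<longrightarrow>
       (\<exists>B. length B \<le> 2 * RP n p * L \<and> is_path_oracle D B E P)"
proof -
  let ?k = "RP n p"
  let ?m = "2 * ?k * L"
  let ?V = "verts n \<times> verts n"
  let ?X = "{xs. set xs \<subseteq> ?V \<and> length xs = ?k}"
  let ?Y = "{bs. set bs \<subseteq> (UNIV :: bool set) \<and> length bs = ?m}"
  have finV: "finite ?V" and cardV: "card ?V = n * n" by (simp_all add: verts_def)
  have "card ?X = (n * n) ^ ?k" using card_lists_length_eq[OF finV] cardV by simp
  also have "\<dots> \<le> (2 ^ L * 2 ^ L) ^ ?k" using L by (intro power_mono mult_mono) auto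
  also have "\<dots> = 2 ^ ?m" by (simp flip: power_add power_mult add: algebra_simps mult_2)
  also have "\<dots> = card ?Y" using card_lists_length_eq[of "UNIV :: bool set" ?m] by simp
  finally have "card ?X \<le> card ?Y" .
  then obtain enc where enc: "enc ` ?X \<subseteq> ?Y" "inj_on enc ?X"
    using card_le_inj[of ?X ?Y] finite_lists_length_eq[OF finV]
      finite_lists_length_eq[of "UNIV :: bool set"] by auto
  define H where "H B = set (inv_into ?X enc B) - Id" for B
  define D :: decoder where "D B s t =
     (if (s, t) \<in> (H B)\<^sup>* then Some (SOME xs. is_path (H B) s t xs) else None)" for B s t
  have "\<exists>B. length B \<le> ?m \<and> is_path_oracle D B E P"
    if EP: "is_digraph n E" "is_demand_set n p P" for E P
  proof -
    obtain F where F: "reach_preserver E P F" "card F \<le> ?k" using RP_preserver[OF EP] by blast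
    have FE: "F \<subseteq> E" using F(1) by (simp add: reach_preserver_def)
    have dF: "is_digraph n F" using digraph_subset[OF EP(1) FE] .
    obtain fs where fs: "set fs = F" "distinct fs"
      using finite_distinct_list[OF digraph_card_le(1)[OF dF]] by blast
    \<comment> \<open>Loops pad the list to the exact length; \<open>H\<close> discards them.\<close>
    define xs where "xs = fs @ replicate (?k - length fs) (0, 0)"
    have "length fs \<le> ?k" using F(2) fs distinct_card by force
    then have xs: "xs \<in> ?X" using n fs(1) dF
      by (auto simp: xs_def verts_def is_digraph_def)
    have "set xs - Id = F" using fs(1) dF by (auto simp: xs_def is_digraph_def)
    then have HF: "H (enc xs) = F" using inv_into_f_f[OF enc(2) xs] by (simp add: H_def)
    have correct: "is_path_oracle D (enc xs) E P"
      unfolding is_path_oracle_def reaches_def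
    proof (clarify, intro conjI impI)
      fix s t assume P: "(s, t) \<in> P"
      {
        assume "(s, t) \<in> E\<^sup>*"
        then have r: "(s, t) \<in> F\<^sup>*" using F(1) P by (auto simp: reach_preserver_def reaches_def)
        have "is_path F s t (SOME xs. is_path F s t xs)"
          using rtrancl_imp_is_path[OF r] by (rule someI_ex)
        then show "\<exists>ys. D (enc xs) s t = Some ys \<and> is_path E s t ys"
          using r is_path_mono[OF _ FE] by (simp add: D_def HF)
      }
      assume "(s, t) \<notin> E\<^sup>*"
      then show "D (enc xs) s t = None" using rtrancl_mono[OF FE] by (auto simp: D_def HF)
    qed
    have "enc xs \<in> ?Y" using enc(1) xs by blast
    then have "length (enc xs) \<le> ?m" by simp
    then show ?thesis using correct by blast
  qed
  then show ?thesis by blast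
qed

lemma le_two_power_ceiling_log:
  assumes "n \<ge> 1"
  shows "n \<le> 2 ^ nat \<lceil>log 2 (real n)\<rceil>"
proof -
  have "log 2 (real n) \<le> real (nat \<lceil>log 2 (real n)\<rceil>)" by linarith
  then have "2 powr log 2 (real n) \<le> 2 powr real (nat \<lceil>log 2 (real n)\<rceil>)"
    by (intro powr_mono) auto
  also have "\<dots> = real (2 ^ nat \<lceil>log 2 (real n)\<rceil>)"
    by (subst powr_realpow) auto
  finally have "real n \<le> real (2 ^ nat \<lceil>log 2 (real n)\<rceil>)" using assms by simp
  then show ?thesis by (simp only: of_nat_le_iff)
qed

lemma PO_le:
  assumes "n \<ge> 1" "n \<le> 2 ^ L"
  shows "PO n p \<le> 2 * RP n p * L"
  unfolding PO_def by (rule Least_le) (rule oracle_from_preservers[OF assms])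

text \<open>The preserver oracle makes some length admissible, so the \<open>LEAST\<close> in
  \<open>PO\<close> is attained. The decoder is fixed before the digraph, as the counting below
  requires.\<close>

lemma PO_decoder:
  assumes "n \<ge> 1"
  obtains D where "\<And>E P. is_digraph n E \<Longrightarrow> is_demand_set n p P \<Longrightarrow>
       \<exists>B. length B \<le> PO n p \<and> is_path_oracle D B E P"
proof -
  have "\<exists>D::decoder. \<forall>E P. is_digraph n E \<and> is_demand_set n p P \<longrightarrow>
       (\<exists>B. length B \<le> PO n p \<and> is_path_oracle D B E P)"
    unfolding PO_def
    by (rule LeastI) (rule oracle_from_preservers[OF assms le_two_power_ceiling_log[OF assms]])
  then show thesis using that by blast
qed

lemma PO_upper:
  assumes n: "n \<ge> 1"
  shows "real (PO n p) \<le> 4 / ln 2 * real (RP n p) * ln (real n)"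
proof -
  let ?L = "nat \<lceil>log 2 (real n)\<rceil>"
  \<comment> \<open>Rounding up at most doubles a logarithm that is at least 1; for
    \<open>n = 1\<close> both sides are 0.\<close>
  have L: "real ?L \<le> 2 * log 2 (real n)"
  proof (cases "n = 1")
    case False
    then have "log 2 (real n) \<ge> 1" using n by simp
    then show ?thesis by linarith
  qed simp
  have "real (PO n p) \<le> real (2 * RP n p * ?L)"
    using PO_le[OF n le_two_power_ceiling_log[OF n]] by (simp only: of_nat_le_iff)
  also have "\<dots> = 2 * real (RP n p) * real ?L" by simp
  also have "\<dots> \<le> 2 * real (RP n p) * (2 * log 2 (real n))"
    using L by (intro mult_left_mono) auto
  also have "\<dots> = 4 / ln 2 * real (RP n p) * ln (real n)" by (simp add: log_def)
  finally show ?thesis .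
qed

section \<open>The lower bound\<close>

text \<open>Without any bits the decoder would answer alike on \<open>E\<close> and on the empty
  digraph, which differ on a demand with distinct ends. This serves the values of \<open>n\<close>
  too small for the twin construction.\<close>

lemma PO_pos:
  assumes n: "n \<ge> 1" and RP: "RP n p \<ge> 1"
  shows "PO n p \<ge> 1"
proof (rule ccontr)
  assume "\<not> PO n p \<ge> 1"
  then have PO: "PO n p = 0" by simp
  obtain E P where EP: "is_digraph n E" "is_demand_set n p P" "RP n p \<le> card E" "critical E P"
    using critical_extremal_digraph[OF RP] .
  have "E \<noteq> {}" using RP EP(3) by auto
  then obtain s t e where st: "(s, t) \<in> P" "(s, t) \<in> E\<^sup>*" "(s, t) \<notin> (E - {e})\<^sup>*"
    using EP(4) unfolding critical_def by blast
  from st(3) have ne: "s \<noteq> t" by auto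
  obtain D where D: "\<And>E P. is_digraph n E \<Longrightarrow> is_demand_set n p P \<Longrightarrow>
       \<exists>B. length B \<le> PO n p \<and> is_path_oracle D B E P"
    using PO_decoder[OF n, of p] by blast
  have "is_path_oracle D [] E P" using D[OF EP(1,2)] PO by auto
  moreover have "is_path_oracle D [] {} P"
    using D[OF digraph_subset[OF EP(1)], of "{}", OF _ EP(2)] PO by auto
  ultimately show False using st ne by (fastforce simp: is_path_oracle_def reaches_def)
qed

section \<open>Contraction to a vertex set and rerouting through twins\<close>

definition crossing :: "(nat \<times> nat) set \<Rightarrow> nat set \<Rightarrow> (nat \<times> nat) set" where
  "crossing E S = E - S \<times> S"

text \<open>A crossing walk may pass through \<open>S\<close>, and its edges may have both ends
  outside \<open>S\<close>. Removing \<open>Id\<close> avoids loops.\<close>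

definition shortcuts :: "(nat \<times> nat) set \<Rightarrow> nat set \<Rightarrow> (nat \<times> nat) set" where
  "shortcuts E S = (S \<times> S \<inter> (crossing E S)\<^sup>*) - Id"

text \<open>The edges from twins to their vertices are present for every \<open>X\<close>; only the
  first half of a rerouted edge depends on \<open>X\<close>.\<close>

definition rerouted ::
  "(nat \<times> nat) set \<Rightarrow> nat set \<Rightarrow> (nat \<Rightarrow> nat) \<Rightarrow> (nat \<times> nat) set \<Rightarrow> (nat \<times> nat) set" where
  "rerouted E S f X = shortcuts E S \<union> (E \<inter> S \<times> S - X) \<union> (\<lambda>(u, v). (u, f v)) ` X \<union> (\<lambda>v. (f v, v)) ` S"

lemma rerouted_iff:
  "(a, b) \<in> rerouted E S f X \<longleftrightarrow> (a, b) \<in> shortcuts E S \<or> (a, b) \<in> E \<inter> S \<times> S - X \<or>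
     (\<exists>v. (a, v) \<in> X \<and> b = f v) \<or> b \<in> S \<and> a = f b"
  unfolding rerouted_def by (auto simp: image_iff)

text \<open>Cut the walk at the start of its first edge inside \<open>S\<close> and at the end of
  its last one. Between consecutive inside edges it is a crossing walk with both ends in
  \<open>S\<close>, hence a shortcut or closed.\<close>

lemma rtrancl_via_shortcuts:
  assumes "(s, t) \<in> E\<^sup>*"
  shows "(s, t) \<in> (crossing E S)\<^sup>* \<or>
    (\<exists>s' t'. s' \<in> S \<and> t' \<in> S \<and> (s, s') \<in> (crossing E S)\<^sup>* \<and>
       (s', t') \<in> (E \<inter> S \<times> S \<union> shortcuts E S)\<^sup>* \<and> (t', t) \<in> (crossing E S)\<^sup>*)"
  using assms
proof (induction rule: rtrancl_induct)
  case base
  then show ?case by simp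
next
  case (step t r)
  let ?G = "E \<inter> S \<times> S \<union> shortcuts E S"
  show ?case
  proof (cases "(t, r) \<in> S \<times> S")
    case False
    then have "(t, r) \<in> crossing E S" using step.hyps by (simp add: crossing_def)
    then show ?thesis using step.IH by (meson rtrancl.rtrancl_into_rtrancl)
  next
    case True
    then have tr: "(t, r) \<in> ?G" using step.hyps by blast
    have "\<exists>s'. s' \<in> S \<and> (s, s') \<in> (crossing E S)\<^sup>* \<and> (s', t) \<in> ?G\<^sup>*"
      using step.IH
    proof (elim disjE exE conjE)
      assume "(s, t) \<in> (crossing E S)\<^sup>*"
      then show ?thesis using True by blast
    next
      fix s' t' assume a: "s' \<in> S" "t' \<in> S" "(s, s') \<in> (crossing E S)\<^sup>*"
        "(s', t') \<in> ?G\<^sup>*" "(t', t) \<in> (crossing E S)\<^sup>*"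
      then have "t' = t \<or> (t', t) \<in> ?G" using True by (auto simp: shortcuts_def)
      then have "(s', t) \<in> ?G\<^sup>*" using a(4) by (auto intro: rtrancl.rtrancl_into_rtrancl)
      then show ?thesis using a by blast
    qed
    then show ?thesis using tr True by (meson SigmaD2 rtrancl.rtrancl_into_rtrancl rtrancl.rtrancl_refl)
  qed
qed

lemma rerouted_digraph:
  assumes "is_digraph n E" "S \<subseteq> verts n" "f ` S \<subseteq> verts n - S" "X \<subseteq> E \<inter> S \<times> S"
  shows "is_digraph n (rerouted E S f X)"
proof -
  have "u \<in> verts n \<and> v \<in> verts n \<and> u \<noteq> v" if "(u, v) \<in> rerouted E S f X" for u v
  proof -
    from that consider "(u, v) \<in> shortcuts E S" | "(u, v) \<in> E"
      | w where "u \<in> S" "w \<in> S" "v = f w" | "v \<in> S" "u = f v"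
      using assms(4) unfolding rerouted_iff by blast
    then show ?thesis
    proof cases
      case 1
      then show ?thesis using assms(2) by (auto simp: shortcuts_def)
    next
      case 2
      then show ?thesis using assms(1) by (auto simp: is_digraph_def)
    next
      case 3
      then show ?thesis using assms(2,3) by blast
    next
      case 4
      then show ?thesis using assms(2,3) by blast
    qed
  qed
  then show ?thesis unfolding is_digraph_def by auto
qed

text \<open>A rerouted edge is still a walk of two edges, so the demands stay reachable whatever
  \<open>X\<close> is.\<close>

lemma rerouted_reaches:
  assumes "(s, t) \<in> (E \<inter> S \<times> S \<union> shortcuts E S)\<^sup>*"
  shows "(s, t) \<in> (rerouted E S f X)\<^sup>*"
proof -
  have "(u, v) \<in> (rerouted E S f X)\<^sup>*" if uv: "(u, v) \<in> E \<inter> S \<times> S \<union> shortcuts E S" for u v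
  proof (cases "(u, v) \<in> X \<and> v \<in> S")
    case True
    then have "(u, f v) \<in> rerouted E S f X" "(f v, v) \<in> rerouted E S f X"
      by (auto simp: rerouted_iff)
    then show ?thesis by (meson r_into_rtrancl rtrancl.rtrancl_into_rtrancl)
  next
    case False
    then have "(u, v) \<in> rerouted E S f X" using uv by (auto simp: rerouted_iff)
    then show ?thesis by blast
  qed
  then have "E \<inter> S \<times> S \<union> shortcuts E S \<subseteq> (rerouted E S f X)\<^sup>*" by auto
  then show ?thesis using assms rtrancl_subset_rtrancl by blast
qed

lemma rtrancl_project:
  assumes "\<And>a b. (a, b) \<in> F \<Longrightarrow> (g a, g b) \<in> G\<^sup>*" "(s, t) \<in> F\<^sup>*"
  shows "(g s, g t) \<in> G\<^sup>*"
  using assms(2) by induction (auto dest: assms(1))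

text \<open>Collapsing each twin onto its vertex maps a common walk to a walk in \<open>E\<close>
  that avoids \<open>e\<close>: shortcuts unfold to crossing edges, straight edges lie outside
  \<open>X\<close>, first halves come from edges in both \<open>X\<close> and \<open>Y\<close>, and
  second halves become points.\<close>

lemma rerouted_Int_reaches:
  assumes f: "inj_on f S" "f ` S \<inter> S = {}"
    and X: "X \<subseteq> E \<inter> S \<times> S" and Y: "Y \<subseteq> E \<inter> S \<times> S"
    and e: "e \<in> X" "e \<notin> Y" and st: "s \<in> S" "t \<in> S"
    and reach: "(s, t) \<in> (rerouted E S f X \<inter> rerouted E S f Y)\<^sup>*"
  shows "(s, t) \<in> (E - {e})\<^sup>*"
proof -
  define g where "g z = (if z \<in> S then z else inv_into S f z)" for z
  have gS: "g v = v" if "v \<in> S" for v using that by (simp add: g_def)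
  have gf: "g (f v) = v" if "v \<in> S" for v using that f by (auto simp: g_def)
  have cr: "crossing E S \<subseteq> E - {e}" using e X by (auto simp: crossing_def)
  have "(g a, g b) \<in> (E - {e})\<^sup>*"
    if ab: "(a, b) \<in> rerouted E S f X \<inter> rerouted E S f Y" for a b
  proof -
    from ab have "(a, b) \<in> rerouted E S f X" by blast
    then consider "(a, b) \<in> shortcuts E S" | "(a, b) \<in> E \<inter> S \<times> S - X"
      | v where "(a, v) \<in> X" "b = f v" | "b \<in> S" "a = f b"
      unfolding rerouted_iff by blast
    then show ?thesis
    proof cases
      case 1
      then have "(a, b) \<in> (crossing E S)\<^sup>*" "a \<in> S" "b \<in> S"
        by (simp_all add: shortcuts_def)
      then have "(a, b) \<in> (E - {e})\<^sup>*" "a \<in> S" "b \<in> S"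
        using rtrancl_mono[OF cr] by (blast, simp_all)
      then show ?thesis by (simp add: gS)
    next
      case 2
      then have "(a, b) \<in> E - {e}" "a \<in> S" "b \<in> S" using e by auto
      then show ?thesis by (auto simp: gS)
    next
      case 3
      then have av: "a \<in> S" "v \<in> S" "(a, v) \<in> E" using X by auto
      then have b: "b \<notin> S" using f(2) 3 by auto
      from ab have "(a, b) \<in> rerouted E S f Y" by blast
      \<comment> \<open>A common edge ending outside \<open>S\<close> must be a first half for
        \<open>Y\<close> as well; injectivity of \<open>f\<close> then identifies the two
        heads.\<close>
      then obtain w where "(a, w) \<in> Y" "b = f w"
        using b unfolding rerouted_iff shortcuts_def by blast
      then have "(a, v) \<in> Y" using 3 av Y f(1) by (metis Int_iff SigmaD2 inj_onD subsetD)
      then have "(a, v) \<in> E - {e}" using av e by auto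
      then show ?thesis using 3 av by (auto simp: gS gf)
    next
      case 4
      then show ?thesis by (simp add: gS gf)
    qed
  qed
  from rtrancl_project[of _ g, OF this reach] show ?thesis using st by (simp add: gS)
qed

section \<open>Counting oracle strings\<close>

lemma sum_two_powers_less: "(\<Sum>i\<le>k. (2::nat) ^ i) < 2 ^ Suc k"
  by (induction k) auto

text \<open>If different subsets \<open>X\<close> and \<open>Y\<close> had the same string, the
  common answer to a demand for which an edge of their difference is critical would avoid that edge.
  So the \<open>2 ^ card ?M\<close> subsets have distinct strings.\<close>

lemma card_spanned_le_PO:
  assumes n: "n \<ge> 1" and E: "is_digraph n E" and P: "is_demand_set n p P" and crit: "critical E P"
    and S: "S \<subseteq> verts n" "2 * card S \<le> n"
  shows "card (E \<inter> S \<times> S) \<le> PO n p"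
proof -
  let ?M = "E \<inter> S \<times> S"
  let ?G = "E \<inter> S \<times> S \<union> shortcuts E S"
  let ?k = "PO n p"
  have finV: "finite (verts n)" and cardV: "card (verts n) = n" by (simp_all add: verts_def)
  have finS: "finite S" using finite_subset[OF S(1) finV] .
  have finM: "finite ?M" using finS by blast
  have "card S \<le> card (verts n - S)"
    using S card_Diff_subset[OF finS S(1)] cardV by linarith
  then obtain f where f: "f ` S \<subseteq> verts n - S" "inj_on f S"
    using card_le_inj[OF finS, of "verts n - S"] finV by auto
  define good where "good q r \<longleftrightarrow> (case (q, r) of ((s, t), (s', t')) \<Rightarrow> s' \<in> S \<and> t' \<in> S \<and>
      (s, s') \<in> (crossing E S)\<^sup>* \<and> (s', t') \<in> ?G\<^sup>* \<and> (t', t) \<in> (crossing E S)\<^sup>*)" for q r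
  define P0 where "P0 = {q \<in> P. \<exists>r. good q r}"
  \<comment> \<open>One inner pair is fixed per demand, independently of the edge under
    consideration; this keeps the number of new demands at most \<open>p\<close>.\<close>
  define h where "h q = (SOME r. good q r)" for q
  have h: "good q (h q)" if "q \<in> P0" for q
    using that someI_ex[of "good q"] by (auto simp: P0_def h_def)
  have P': "P \<subseteq> verts n \<times> verts n" "finite P" "card P = p" using P by (auto simp: is_demand_set_def)
  have "finite P0" "card P0 \<le> p" using P' by (auto simp: P0_def intro: card_mono)
  then have hc: "card (h ` P0) \<le> p" using card_image_le le_trans by blast
  have hS: "h ` P0 \<subseteq> verts n \<times> verts n" using h S(1) by (fastforce simp: good_def)
  have "p \<le> card (verts n \<times> verts n)" using P' finV card_mono[OF _ P'(1)] by simp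
  \<comment> \<open>\<open>h\<close> may merge demands, so its image is padded to exactly
    \<open>p\<close> pairs.\<close>
  then obtain Q where Q: "h ` P0 \<subseteq> Q" "Q \<subseteq> verts n \<times> verts n" "card Q = p"
    using exists_subset_between[OF hc _ hS finite_cartesian_product[OF finV finV]] by blast
  have dQ: "is_demand_set n p Q"
    using Q finite_subset[OF Q(2)] finV by (simp add: is_demand_set_def)
  have demand: "\<exists>(s, t) \<in> Q. s \<in> S \<and> t \<in> S \<and> (s, t) \<in> ?G\<^sup>* \<and> (s, t) \<notin> (E - {e})\<^sup>*"
    if e: "e \<in> ?M" for e
  proof -
    obtain s t where st: "(s, t) \<in> P" "(s, t) \<in> E\<^sup>*" "(s, t) \<notin> (E - {e})\<^sup>*"
      using crit e unfolding critical_def by blast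
    have "crossing E S \<subseteq> E - {e}" using e by (auto simp: crossing_def)
    then have cr: "(crossing E S)\<^sup>* \<subseteq> (E - {e})\<^sup>*" by (rule rtrancl_mono)
    then have "(s, t) \<notin> (crossing E S)\<^sup>*" using st(3) by blast
    with rtrancl_via_shortcuts[OF st(2), of S] have "\<exists>r. good (s, t) r"
      by (auto simp: good_def)
    then have P0: "(s, t) \<in> P0" using st(1) by (simp add: P0_def)
    obtain s' t' where r: "h (s, t) = (s', t')" by fastforce
    have a: "s' \<in> S" "t' \<in> S" "(s, s') \<in> (crossing E S)\<^sup>*" "(s', t') \<in> ?G\<^sup>*"
        "(t', t) \<in> (crossing E S)\<^sup>*"
      using h[OF P0] by (auto simp: good_def r)
    \<comment> \<open>A walk from \<open>s'\<close> to \<open>t'\<close> avoiding \<open>e\<close>,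
      extended by the two crossing walks, would connect \<open>s\<close> to \<open>t\<close> without
      \<open>e\<close>.\<close>
    have "(s', t') \<notin> (E - {e})\<^sup>*"
      using a cr st(3) by (meson rtrancl_trans subsetD)
    moreover have "(s', t') \<in> Q" using Q(1) P0 r by force
    ultimately show ?thesis using a by blast
  qed
  obtain D where D: "\<And>E P. is_digraph n E \<Longrightarrow> is_demand_set n p P \<Longrightarrow>
       \<exists>B. length B \<le> PO n p \<and> is_path_oracle D B E P"
    using PO_decoder[OF n, of p] by blast
  have "\<forall>X\<in>Pow ?M. \<exists>B. length B \<le> ?k \<and> is_path_oracle D B (rerouted E S f X) Q"
    using D[OF rerouted_digraph[OF E S(1) f(1)] dQ] by blast
  then obtain B where B: "\<And>X. X \<subseteq> ?M \<Longrightarrow> length (B X) \<le> ?k"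
      "\<And>X. X \<subseteq> ?M \<Longrightarrow> is_path_oracle D (B X) (rerouted E S f X) Q"
    unfolding Pow_def by (metis (no_types, lifting) mem_Collect_eq)
  have sub: "X \<subseteq> Y" if XY: "X \<subseteq> ?M" "Y \<subseteq> ?M" "B X = B Y" for X Y
  proof
    fix e assume e: "e \<in> X"
    show "e \<in> Y"
    proof (rule ccontr)
      assume eY: "e \<notin> Y"
      obtain s t where st: "(s, t) \<in> Q" "s \<in> S" "t \<in> S" "(s, t) \<in> ?G\<^sup>*" "(s, t) \<notin> (E - {e})\<^sup>*"
        using demand XY(1) e by blast
      have "\<exists>xs. D (B Z) s t = Some xs \<and> is_path (rerouted E S f Z) s t xs" if "Z \<subseteq> ?M" for Z
        using B(2)[OF that] st(1) rerouted_reaches[OF st(4)]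
        by (auto simp: is_path_oracle_def reaches_def)
      from this[OF XY(1)] this[OF XY(2)] obtain xs where
        "is_path (rerouted E S f X) s t xs" "is_path (rerouted E S f Y) s t xs"
        using XY(3) by auto
      then have "(s, t) \<in> (rerouted E S f X \<inter> rerouted E S f Y)\<^sup>*"
        using is_path_Int is_path_imp_rtrancl by blast
      then show False
        using rerouted_Int_reaches[OF f(2) _ XY(1,2) e eY st(2,3)] f(1) st(5) by blast
    qed
  qed
  have "inj_on B (Pow ?M)"
  proof (rule inj_onI)
    fix X Y assume "X \<in> Pow ?M" "Y \<in> Pow ?M" "B X = B Y"
    then show "X = Y" using sub[of X Y] sub[of Y X] by (intro equalityI) (simp_all only: Pow_iff)
  qed
  moreover have "B ` Pow ?M \<subseteq> {bs. set bs \<subseteq> UNIV \<and> length bs \<le> ?k}" using B(1) by auto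
  ultimately have "card (Pow ?M) \<le> card {bs. set bs \<subseteq> (UNIV :: bool set) \<and> length bs \<le> ?k}"
    by (rule card_inj_on_le) (rule finite_lists_length_le, simp)
  \<comment> \<open>All lengths up to \<open>?k\<close> are counted, which gives fewer than
    \<open>2 ^ Suc ?k\<close> strings; strictness recovers the bound \<open>?k\<close>
    itself.\<close>
  then have "2 ^ card ?M \<le> (\<Sum>i\<le>?k. (2::nat) ^ i)"
    using card_lists_length_le[of "UNIV :: bool set" ?k] by (simp add: card_Pow[OF finM] del: Pow_Int_eq)
  also have "\<dots> < 2 ^ Suc ?k" by (rule sum_two_powers_less)
  finally have "card ?M < Suc ?k" by (rule power_less_imp_less_exp[rotated]) simp
  then show ?thesis by simp
qed

section \<open>Covering the edges by small vertex sets\<close>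

lemma card_residue_class_le: "card {v \<in> verts n. v mod 8 = i} \<le> (n + 7) div 8"
proof -
  have "inj_on (\<lambda>v. v div 8) {v \<in> verts n. v mod 8 = i}"
    by (rule inj_onI) (metis (mono_tags, lifting) div_mult_mod_eq mem_Collect_eq)
  moreover have "(\<lambda>v. v div 8) ` {v \<in> verts n. v mod 8 = i} \<subseteq> {..<(n + 7) div 8}"
    by (auto simp: verts_def)
  ultimately show ?thesis using card_inj_on_le[OF _ _ finite_lessThan] card_lessThan by metis
qed

text \<open>The residues of its two ends modulo 8 place every edge inside one of 64 unions of two
  residue classes. Eight classes rather than four leave room for rounding: each union has at most
  half of the vertices once \<open>n\<close> is at least 4. For smaller \<open>n\<close> the bound 9
  on \<open>RP n p\<close> suffices.\<close>

lemma RP_le_PO: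
  assumes n: "n \<ge> 1"
  shows "RP n p \<le> 64 * PO n p"
proof (cases "RP n p = 0")
  case False
  then have RP: "RP n p \<ge> 1" by simp
  show ?thesis
  proof (cases "n \<ge> 4")
    case False
    then have "n * n \<le> 3 * 3" by (intro mult_mono) auto
    then show ?thesis using RP_le_square[of n p] PO_pos[OF n RP] by linarith
  next
    case True
    obtain E P where EP: "is_digraph n E" "is_demand_set n p P" "RP n p \<le> card E" "critical E P"
      using critical_extremal_digraph[OF RP] .
    define S where "S = (\<lambda>(i, j). {v \<in> verts n. v mod 8 = i} \<union> {v \<in> verts n. v mod 8 = j})"
    let ?I = "{..<8::nat} \<times> {..<8::nat}"
    have bound: "card (E \<inter> S ij \<times> S ij) \<le> PO n p" for ij
    proof -
      obtain i j where ij: "ij = (i, j)" by fastforce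
      have "card (S ij) \<le> (n + 7) div 8 + (n + 7) div 8"
        unfolding S_def ij prod.case
        by (rule le_trans[OF card_Un_le add_mono[OF card_residue_class_le card_residue_class_le]])
      then have "2 * card (S ij) \<le> 4 * ((n + 7) div 8)" by simp
      also have "\<dots> \<le> n" using True by presburger
      finally have "2 * card (S ij) \<le> n" .
      moreover have "S ij \<subseteq> verts n" by (auto simp: S_def ij)
      ultimately show ?thesis using card_spanned_le_PO[OF n EP(1,2,4)] by blast
    qed
    have "E \<subseteq> (\<Union>ij\<in>?I. E \<inter> S ij \<times> S ij)"
    proof
      fix e assume e: "e \<in> E"
      obtain u v where uv: "e = (u, v)" by fastforce
      have "e \<in> E \<inter> S (u mod 8, v mod 8) \<times> S (u mod 8, v mod 8)"
        using e EP(1) uv by (auto simp: S_def is_digraph_def)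
      moreover have "(u mod 8, v mod 8) \<in> ?I" by simp
      ultimately show "e \<in> (\<Union>ij\<in>?I. E \<inter> S ij \<times> S ij)" by blast
    qed
    then have "card E \<le> card (\<Union>ij\<in>?I. E \<inter> S ij \<times> S ij)"
      using digraph_card_le(1)[OF EP(1)] by (intro card_mono) auto
    also have "\<dots> \<le> (\<Sum>ij\<in>?I. card (E \<inter> S ij \<times> S ij))" by (rule card_UN_le) simp
    also have "\<dots> \<le> of_nat (card ?I) * PO n p" using bound by (intro sum_bounded_above)
    also have "\<dots> = 64 * PO n p" by simp
    finally show ?thesis using EP(3) by linarith
  qed
qed simp

theorem theorem4p16:
  shows "\<exists>c C :: real. c > 0 \<and> C > 0 \<and>
    (\<forall>n p :: nat. n \<ge> 1 \<longrightarrow> p \<ge> 1 \<longrightarrow>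
       c * real (RP n p) \<le> real (PO n p) \<and>
       real (PO n p) \<le> C * real (RP n p) * ln (real n))"
proof (rule exI[of _ "1 / 64"], rule exI[of _ "4 / ln 2"], intro conjI allI impI)
  fix n p :: nat
  assume n: "n \<ge> 1"
  have "real (RP n p) \<le> real (64 * PO n p)" using RP_le_PO[OF n] by (simp only: of_nat_le_iff)
  then show "1 / 64 * real (RP n p) \<le> real (PO n p)" by simp
  show "real (PO n p) \<le> 4 / ln 2 * real (RP n p) * ln (real n)" using PO_upper[OF n] .
qed simp_all

end
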